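(* For integers $n, m \geq 0$, let $D^o_{2,1}(n, m)$ be the number of partitions of $n$ into $m$ parts $\lambda_1 \leq \cdots \leq \lambda_m$ in which the smallest part is at least $2$, $\lambda_{i+1} - \lambda_i \geq 2$ for all $i$, and $\lambda_{i+1} - \lambda_i \geq 3$ unless $\lambda_i$ and $\lambda_{i+1}$ are both odd. Then \[ \sum_{m, n \geq 0} D^o_{2,1}(n, m) q^n x^m = \sum_{n_1, n_2 \geq 0} \frac{ q^{4n_2^2 + 4n_2 + (3n_1^2 + 3n_1)/2 + 4n_2 n_1} (1 + xq^{4n_2 + 2n_1 + 2}) x^{2n_2 + n_1} }{ (q; q)_{n_1} (q^4; q^4)_{n_2} }. \]
   Context: A partition of $n$ into $m$ parts is a non-decreasing sequence of $m$ positive integers summing to $n$. For $n \geq 0$, $(a; q)_n = \prod_{j=1}^{n} (1 - a q^{j-1})$, with the empty product equal to $1$. *)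

theory Defs
  imports
    "HOL-Analysis.Infinite_Sum"
    "HOL-Computational_Algebra.Formal_Power_Series"
begin

definition qpoch :: "'a::comm_ring_1 \<Rightarrow> 'a \<Rightarrow> nat \<Rightarrow> 'a" where
  "qpoch a q n = (\<Prod>j=1..n. 1 - a * q ^ (j - 1))"

definition is_partition :: "nat \<Rightarrow> nat \<Rightarrow> nat list \<Rightarrow> bool" where
  "is_partition n m ps \<longleftrightarrow>
     length ps = m \<and> sorted ps \<and> (\<forall>p\<in>set ps. 0 < p) \<and> sum_list ps = n"

text \<open>
  The list index \<open>i\<close> starts at 0. Truncated subtraction is harmless in the gap conditions
  because their lower bounds are positive. The empty partition of 0 into 0 parts is counted.
\<close>

definition Do21 :: "nat \<Rightarrow> nat \<Rightarrow> nat" where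
  "Do21 n m = card {ps. is_partition n m ps \<and>
     (\<forall>p\<in>set ps. 2 \<le> p) \<and>
     (\<forall>i. i + 1 < m \<longrightarrow> ps ! (i + 1) - ps ! i \<ge> 2) \<and>
     (\<forall>i. i + 1 < m \<longrightarrow> \<not> (odd (ps ! i) \<and> odd (ps ! (i + 1)))
        \<longrightarrow> ps ! (i + 1) - ps ! i \<ge> 3)}"

text \<open>
  Bivariate series are elements of \<open>rat fps fps\<close>, i.e. of \<open>\<rat>[[q]][[x]]\<close>: the outer variable is \<open>x\<close>,
  the inner one is \<open>q\<close>, and \<open>fps_const\<close> embeds \<open>\<rat>[[q]]\<close>. Thus the coefficient of
  \<open>q ^ n * x ^ m\<close> in \<open>F\<close> is \<open>fps_nth (fps_nth F m) n\<close>.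
\<close>

definition bivariate_gf :: "(nat \<Rightarrow> nat \<Rightarrow> nat) \<Rightarrow> rat fps fps" where
  "bivariate_gf D = Abs_fps (\<lambda>m. Abs_fps (\<lambda>n. of_nat (D n m)))"

end

theory Submission
  imports Defs
begin

unbundle fps_syntax

text \<open>
  Let \<open>G\<^sub>j(x)\<close> count the admissible partitions with parts \<open>\<ge> j\<close>. Removing a smallest part equal to
  \<open>2\<close> or \<open>3\<close> leaves in both cases an arbitrary admissible partition with parts \<open>\<ge> 5\<close>, and adding
  \<open>2\<close> to all parts gives \<open>G\<^bsub>j+2\<^esub>(x) = G\<^sub>j(x q\<^sup>2)\<close>. Hence \<open>G\<^sub>2(x) = G\<^sub>3(x) + x q\<^sup>2 G\<^sub>3(x q\<^sup>2)\<close> and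
  \<open>G\<^sub>3(x) = G\<^sub>2(x q\<^sup>2) + x q\<^sup>3 G\<^sub>3(x q\<^sup>2)\<close>, so the coefficients of \<open>G\<^sub>3\<close> satisfy
  \<open>(1 - q\<^bsup>2m+2\<^esup>) g\<^bsub>m+1\<^esub> = q\<^bsup>2m+3\<^esup> (1 + q\<^bsup>2m+1\<^esup>) g\<^sub>m\<close>. The factor \<open>1 + x q\<^bsup>4n\<^sub>2+2n\<^sub>1+2\<^esup>\<close> of the
  double sum corresponds to the relation between \<open>G\<^sub>2\<close> and \<open>G\<^sub>3\<close>. After extracting \<open>q\<^bsup>m\<^sup>2+2m\<^esup>\<close> from
  the coefficient of \<open>x\<^sup>m\<close>, the rest of the double sum is \<open>A(z) B(z)\<close> with
  \<open>A(z) = \<Sum> q\<^bsup>n(n-1)/2\<^esup> z\<^sup>n / (q;q)\<^sub>n\<close> and \<open>B(z) = \<Sum> z\<^bsup>2n\<^esup> / (q\<^sup>4;q\<^sup>4)\<^sub>n\<close>. From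
  \<open>A(z) = (1 + z) A(q z)\<close> and \<open>(1 - z\<^sup>2) B(z) = B(q\<^sup>2 z)\<close> one gets
  \<open>(1 - z) A(z) B(z) = (1 + q z) A(q\<^sup>2 z) B(q\<^sup>2 z)\<close>, which is the same recurrence.
\<close>

section \<open>Admissible partitions\<close>

definition gap_ok :: "nat \<Rightarrow> nat \<Rightarrow> bool" where
  "gap_ok a b \<longleftrightarrow> a + 2 \<le> b \<and> (odd a \<and> odd b \<or> a + 3 \<le> b)"

definition gap_partitions :: "nat \<Rightarrow> nat \<Rightarrow> nat \<Rightarrow> nat list set" where
  "gap_partitions j m n =
     {ps. length ps = m \<and> successively gap_ok ps \<and> (\<forall>p\<in>set ps. j \<le> p) \<and> sum_list ps = n}"

definition gap_gf :: "nat \<Rightarrow> nat \<Rightarrow> 'a::semiring_1 fps" where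
  "gap_gf j m = Abs_fps (\<lambda>n. of_nat (card (gap_partitions j m n)))"

lemma sorted_wrt_if_gap_ok:
  assumes "successively gap_ok ps"
  shows "sorted_wrt (<) ps"
proof -
  have "successively (<) ps"
    using assms by (rule successively_mono) (auto simp: gap_ok_def)
  then show ?thesis
    by (simp add: successively_conv_sorted_wrt)
qed

lemma finite_gap_partitions: "finite (gap_partitions j m n)"
proof (rule finite_subset)
  show "gap_partitions j m n \<subseteq> {ps. set ps \<subseteq> {..n} \<and> length ps = m}"
    by (auto simp: gap_partitions_def member_le_sum_list)
qed (simp add: finite_lists_length_eq)

text \<open>A gap of exactly 2 preserves parity, so \<open>gap_ok j\<close> amounts to a threshold
  \<open>k\<close>: \<open>j + 2\<close> for odd \<open>j\<close>, \<open>j + 3\<close> for even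
  \<open>j\<close>. As the list increases, testing the head of \<open>ps\<close> bounds all its
  parts.\<close>

lemma gap_partitions_Cons:
  assumes next_iff: "\<And>b. gap_ok j b \<longleftrightarrow> k \<le> b"
  shows "j # ps \<in> gap_partitions j (Suc m) n \<longleftrightarrow> j \<le> n \<and> ps \<in> gap_partitions k m (n - j)"
proof -
  have "j \<le> k"
    using next_iff[of k] by (simp add: gap_ok_def)
  moreover have "(ps = [] \<or> gap_ok j (hd ps)) \<longleftrightarrow> (\<forall>p\<in>set ps. k \<le> p)" if "successively gap_ok ps"
    using sorted_wrt_if_gap_ok[OF that] next_iff by (cases ps) (auto intro: order_trans less_imp_le)
  ultimately show ?thesis
    by (auto simp: gap_partitions_def successively_Cons)
qed

text \<open>Parts increase strictly, so a list whose head is not \<open>j\<close> has either all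
  parts above \<open>j\<close> or a head below \<open>j\<close>.\<close>

lemma gap_partitions_split:
  assumes "\<And>b. gap_ok j b \<longleftrightarrow> k \<le> b"
  shows "gap_partitions j (Suc m) n = gap_partitions (Suc j) (Suc m) n \<union>
           (if j \<le> n then (#) j ` gap_partitions k m (n - j) else {})" (is "?L = ?R")
proof (intro set_eqI)
  fix ps
  show "ps \<in> ?L \<longleftrightarrow> ps \<in> ?R"
  proof (cases "ps \<noteq> [] \<and> hd ps = j")
    case True
    then obtain qs where "ps = j # qs"
      by (cases ps) auto
    then show ?thesis
      using gap_partitions_Cons[OF assms, of qs m n] by (auto simp: gap_partitions_def)
  next
    case False
    then have "ps \<in> gap_partitions j (Suc m) n \<longleftrightarrow> ps \<in> gap_partitions (Suc j) (Suc m) n"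
      using sorted_wrt_if_gap_ok[of ps]
      by (cases ps) (auto simp: gap_partitions_def Suc_le_eq intro: le_less_trans)
    then show ?thesis
      using False by auto
  qed
qed

lemma gap_gf_split:
  assumes "\<And>b. gap_ok j b \<longleftrightarrow> k \<le> b"
  shows "gap_gf j (Suc m) = gap_gf (Suc j) (Suc m) + fps_X ^ j * gap_gf k m"
proof (rule fps_ext)
  fix n
  have "j # ps \<notin> gap_partitions (Suc j) (Suc m) n" for ps
    by (simp add: gap_partitions_def)
  then have "gap_partitions (Suc j) (Suc m) n \<inter> (#) j ` gap_partitions k m (n - j) = {}"
    by blast
  then have "card (gap_partitions j (Suc m) n) = card (gap_partitions (Suc j) (Suc m) n) +
      (if j \<le> n then card (gap_partitions k m (n - j)) else 0)"
    unfolding gap_partitions_split[OF assms]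
    by (simp add: card_Un_disjoint finite_gap_partitions card_image)
  then show "gap_gf j (Suc m) $ n = (gap_gf (Suc j) (Suc m) + fps_X ^ j * gap_gf k m) $ n"
    by (simp add: gap_gf_def fps_X_power_mult_nth)
qed

text \<open>Adding 2 to every part keeps differences and parities, and raises the sum by 2 per
  part.\<close>

lemma gap_partitions_shift:
  "gap_partitions (j + 2) m n =
     (if 2 * m \<le> n then map (\<lambda>p. p + 2) ` gap_partitions j m (n - 2 * m) else {})" (is "?L = ?R")
proof -
  have gap_shift: "gap_ok (a + 2) (b + 2) \<longleftrightarrow> gap_ok a b" for a b
    by (auto simp: gap_ok_def)
  have sum_shift: "sum_list (map (\<lambda>p. p + 2) ps) = sum_list ps + 2 * length ps" for ps :: "nat list"
    by (induction ps) simp_all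
  have mem: "map (\<lambda>p. p + 2) qs \<in> ?L \<longleftrightarrow> 2 * m \<le> n \<and> qs \<in> gap_partitions j m (n - 2 * m)" for qs
    unfolding gap_partitions_def mem_Collect_eq successively_map gap_shift sum_shift by auto
  have "ps \<in> range (map (\<lambda>p. p + 2))" if "ps \<in> ?L" for ps
  proof
    \<comment> \<open>All parts are at least \<open>j + 2\<close>, so the truncated subtraction is
      exact.\<close>
    show "ps = map (\<lambda>p. p + 2) (map (\<lambda>p. p - 2) ps)"
      using that by (auto simp: gap_partitions_def intro!: map_idI[symmetric])
  qed simp
  then show ?thesis
    using mem by (auto split: if_splits)
qed

lemma gap_gf_shift: "gap_gf (j + 2) m = fps_X ^ (2 * m) * gap_gf j m"
proof (rule fps_ext)
  fix n
  have "inj (map (\<lambda>p::nat. p + 2))"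
    by (simp add: inj_mapI inj_def)
  then show "gap_gf (j + 2) m $ n = (fps_X ^ (2 * m) * gap_gf j m) $ n"
    unfolding gap_gf_def gap_partitions_shift
    by (simp add: fps_X_power_mult_nth card_image inj_on_subset[OF _ subset_UNIV])
qed

lemma gap_gf_0: "gap_gf j 0 = 1"
proof -
  have "gap_partitions j 0 n = (if n = 0 then {[]} else {})" for n
    by (auto simp: gap_partitions_def)
  then show ?thesis
    by (intro fps_ext) (simp add: gap_gf_def)
qed

text \<open>The exponent is 2 for the removed part plus \<open>2 * m\<close> for lowering the other
  \<open>m\<close> parts from bound 5 to bound 3.\<close>

lemma gap_gf_2_Suc:
  "gap_gf 2 (Suc m) =
     gap_gf 3 (Suc m) + fps_X ^ (2 * m + 2) * (gap_gf 3 m :: 'a::comm_ring_1 fps)"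
proof -
  have "gap_gf 2 (Suc m) = gap_gf 3 (Suc m) + fps_X ^ 2 * (gap_gf 5 m :: 'a fps)"
    using gap_gf_split[of 2 5 m] by (force simp: gap_ok_def)
  then show ?thesis
    using gap_gf_shift[of 3 m, where 'a = 'a] by (simp add: power_add power2_eq_square mult_ac)
qed

text \<open>Split off a part 3, read bound 4 as a shift of bound 2, and eliminate the latter by
  \<open>gap_gf_2_Suc\<close>.\<close>

lemma gap_gf_3_Suc:
  "gap_gf 3 (Suc m) * (1 - fps_X ^ (2 * m + 2)) =
     fps_X ^ (2 * m + 3) * (1 + fps_X ^ (2 * m + 1)) * (gap_gf 3 m :: 'a::comm_ring_1 fps)"
proof -
  have "gap_ok 3 b \<longleftrightarrow> 5 \<le> b" for b
  \<comment> \<open>Only at 5 is the gap exactly 2, so only there does oddness matter.\<close>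
  proof (cases "b = 5")
    case False
    then show ?thesis by (auto simp: gap_ok_def)
  qed (simp add: gap_ok_def)
  then have "gap_gf 3 (Suc m) = gap_gf 4 (Suc m) + fps_X ^ 3 * (gap_gf 5 m :: 'a fps)"
    using gap_gf_split[of 3 5 m] by simp
  also have "gap_gf 4 (Suc m) = fps_X ^ (2 * m + 2) * (gap_gf 2 (Suc m) :: 'a fps)"
    using gap_gf_shift[of 2 "Suc m"] by simp
  also have "gap_gf 5 m = fps_X ^ (2 * m) * (gap_gf 3 m :: 'a fps)"
    using gap_gf_shift[of 3 m] by simp
  finally have rec: "gap_gf 3 (Suc m) =
      fps_X ^ (2 * m + 2) * (gap_gf 3 (Suc m) + fps_X ^ (2 * m + 2) * gap_gf 3 m) +
      fps_X ^ (2 * m + 3) * (gap_gf 3 m :: 'a fps)"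
    unfolding gap_gf_2_Suc by (simp only: power_add mult_ac)
  have "fps_X ^ (2 * m + 3) * fps_X ^ (2 * m + 1) =
      fps_X ^ (2 * m + 2) * (fps_X ^ (2 * m + 2) :: 'a fps)"
    unfolding power_add[symmetric] by (rule arg_cong[where f = "(^) fps_X"]) simp
  then have "fps_X ^ (2 * m + 3) * (1 + fps_X ^ (2 * m + 1)) * (gap_gf 3 m :: 'a fps) =
      fps_X ^ (2 * m + 3) * gap_gf 3 m + fps_X ^ (2 * m + 2) * (fps_X ^ (2 * m + 2) * gap_gf 3 m)"
    by (simp only: distrib_left distrib_right mult_1_right mult.assoc[symmetric])
  also have "\<dots> = gap_gf 3 (Suc m) - fps_X ^ (2 * m + 2) * gap_gf 3 (Suc m)"
    using rec by (simp only: distrib_left eq_diff_eq add_ac)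
  finally show ?thesis
    by (simp add: right_diff_distrib mult.commute)
qed

lemma Do21_eq_card_gap_partitions: "Do21 n m = card (gap_partitions 2 m n)"
proof -
  have "(is_partition n m ps \<and> (\<forall>p\<in>set ps. 2 \<le> p) \<and>
      (\<forall>i. i + 1 < m \<longrightarrow> ps ! (i + 1) - ps ! i \<ge> 2) \<and>
      (\<forall>i. i + 1 < m \<longrightarrow> \<not> (odd (ps ! i) \<and> odd (ps ! (i + 1))) \<longrightarrow> ps ! (i + 1) - ps ! i \<ge> 3))
    \<longleftrightarrow> ps \<in> gap_partitions 2 m n" (is "?D \<longleftrightarrow> _") for ps
  proof
    assume ?D
    then have "gap_ok (ps ! i) (ps ! Suc i)" if "Suc i < m" for i
      using that unfolding gap_ok_def by fastforce
    then show "ps \<in> gap_partitions 2 m n"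
      using \<open>?D\<close> by (auto simp: gap_partitions_def is_partition_def successively_conv_nth)
  next
    assume ps: "ps \<in> gap_partitions 2 m n"
    then have "gap_ok (ps ! i) (ps ! (i + 1))" if "i + 1 < m" for i
      using that by (simp add: gap_partitions_def successively_nth)
    moreover have "sorted ps"
      using ps sorted_wrt_if_gap_ok[of ps]
      by (auto simp: gap_partitions_def strict_sorted_imp_sorted)
    ultimately show ?D
      using ps by (fastforce simp: gap_partitions_def is_partition_def gap_ok_def)
  qed
  then show ?thesis
    unfolding Do21_def by simp
qed

lemma bivariate_gf_Do21_nth: "bivariate_gf Do21 $ m = gap_gf 2 m"
  by (simp add: bivariate_gf_def gap_gf_def Do21_eq_card_gap_partitions)

section \<open>The double sum\<close>

lemma qpoch_Suc: "qpoch a q (Suc n) = qpoch a q n * (1 - a * q ^ n)"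
  by (simp add: qpoch_def)

lemma qpoch_nth_0:
  fixes a q :: "'a::comm_ring_1 fps"
  assumes "a $ 0 = 0"
  shows "qpoch a q n $ 0 = 1"
  by (induction n) (simp_all add: qpoch_Suc assms, simp add: qpoch_def)

lemma inverse_qpoch_Suc:
  fixes a q :: "'a::field fps"
  assumes "a $ 0 = 0"
  shows "inverse (qpoch a q (Suc n)) * (1 - a * q ^ n) = inverse (qpoch a q n)"
proof -
  have "(1 - a * q ^ n) $ 0 \<noteq> 0"
    using assms by simp
  then show ?thesis
    unfolding qpoch_Suc fps_inverse_mult by (simp add: mult.assoc inverse_mult_eq_1)
qed

section \<open>Dilations z -> c z and two Euler products\<close>

definition fps_dilate :: "'a::comm_ring_1 \<Rightarrow> 'a fps \<Rightarrow> 'a fps" where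
  "fps_dilate c f = Abs_fps (\<lambda>n. c ^ n * f $ n)"

lemma fps_dilate_nth: "fps_dilate c f $ n = c ^ n * f $ n"
  by (simp add: fps_dilate_def)

lemma fps_dilate_mult: "fps_dilate c (f * g) = fps_dilate c f * fps_dilate c g"
proof (rule fps_ext)
  fix n
  have "c ^ n * (f $ i * g $ (n - i)) = c ^ i * f $ i * (c ^ (n - i) * g $ (n - i))" if "i \<le> n" for i
  proof -
    have "c ^ n = c ^ i * c ^ (n - i)"
      using that by (simp flip: power_add)
    then show ?thesis by (simp add: mult_ac)
  qed
  then show "fps_dilate c (f * g) $ n = (fps_dilate c f * fps_dilate c g) $ n"
    by (simp add: fps_dilate_nth fps_mult_nth sum_distrib_left)
qed

lemma fps_dilate_dilate: "fps_dilate c (fps_dilate d f) = fps_dilate (c * d) f"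
  by (intro fps_ext) (simp add: fps_dilate_nth power_mult_distrib mult.assoc)

lemma fps_dilate_one_plus_X: "fps_dilate c (1 + fps_X) = 1 + fps_const c * fps_X"
  by (intro fps_ext) (simp add: fps_dilate_nth fps_X_def)

definition euler_coeff :: "nat \<Rightarrow> 'a::field fps" where
  "euler_coeff n = fps_X ^ (n choose 2) * inverse (qpoch fps_X fps_X n)"

definition even_coeff :: "nat \<Rightarrow> 'a::field fps" where
  "even_coeff n = inverse (qpoch (fps_X ^ 4) (fps_X ^ 4) n)"

text \<open>With z the outer and q the inner variable, this is Euler's expansion of the product of
  all 1 + z q^k, k \<ge> 0.\<close>

definition euler_series :: "'a::field fps fps" where
  "euler_series = Abs_fps euler_coeff"

text \<open>Likewise the expansion of the reciprocal of the product of all 1 - z^2 q^(4k).\<close>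

definition even_series :: "'a::field fps fps" where
  "even_series = Abs_fps (\<lambda>n. if even n then even_coeff (n div 2) else 0)"

lemma euler_coeff_Suc: "euler_coeff (Suc n) * (1 - fps_X ^ Suc n) = fps_X ^ n * euler_coeff n"
proof -
  have "Suc n choose 2 = n + (n choose 2)"
    by (simp add: numeral_2_eq_2)
  then show ?thesis
    using inverse_qpoch_Suc[of fps_X fps_X n]
    by (simp add: euler_coeff_def power_add mult_ac)
qed

lemma even_coeff_Suc: "even_coeff (Suc n) * (1 - fps_X ^ (4 * Suc n)) = even_coeff n"
  using inverse_qpoch_Suc[of "fps_X ^ 4" "fps_X ^ 4" n]
  by (simp add: even_coeff_def power_add flip: power_mult)

lemma euler_series_dilate: "euler_series = (1 + fps_X) * fps_dilate fps_X euler_series"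
proof (rule fps_ext)
  fix n
  show "euler_series $ n = ((1 + fps_X) * fps_dilate fps_X euler_series) $ n"
  proof (cases n)
    case 0
    then show ?thesis
      by (simp add: euler_series_def fps_dilate_nth fps_mult_nth)
  next
    case (Suc k)
    have "euler_coeff (Suc k) = fps_X ^ Suc k * euler_coeff (Suc k) + fps_X ^ k * euler_coeff k"
      using euler_coeff_Suc[of k] by (simp add: algebra_simps)
    then show ?thesis
      by (simp add: Suc distrib_right fps_dilate_nth euler_series_def)
  qed
qed

lemma even_series_dilate:
  "fps_dilate (fps_X ^ 2) even_series = (1 - fps_X ^ 2) * (even_series :: 'a::field fps fps)"
proof (rule fps_ext)
  fix n
  show "fps_dilate (fps_X ^ 2) even_series $ n =
      ((1 - fps_X ^ 2) * (even_series :: 'a fps fps)) $ n"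
  proof (cases "even n \<and> n \<noteq> 0")
    case False
    then show ?thesis
      by (auto simp: left_diff_distrib fps_X_power_mult_nth fps_dilate_nth even_series_def)
  next
    case True
    then obtain k where n: "n = 2 * Suc k"
      by (metis dvdE mult_0_right not0_implies_Suc)
    have "(fps_X ^ 2) ^ n = (fps_X ^ (4 * Suc k) :: 'a fps)"
      by (simp add: n power_add flip: power_mult)
    then have "(fps_X ^ 2) ^ n * even_coeff (Suc k) = even_coeff (Suc k) - (even_coeff k :: 'a fps)"
      unfolding even_coeff_Suc[of k, symmetric] by (simp only: right_diff_distrib mult_1_right) simp
    then show ?thesis
      by (simp add: n left_diff_distrib fps_X_power_mult_nth fps_dilate_nth even_series_def)
  qed
qed

text \<open>Two dilations by q match the single dilation by q^2 of the even series. The common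
  factor 1 + z of A(z) and 1 - z^2 then cancels.\<close>

lemma product_series_dilate:
  defines "P \<equiv> euler_series * (even_series :: 'a::field fps fps)"
  shows "(1 - fps_X) * P = (1 + fps_const fps_X * fps_X) * fps_dilate (fps_X ^ 2) P"
proof -
  let ?A = "euler_series :: 'a fps fps" and ?B = "even_series :: 'a fps fps"
  have "fps_dilate fps_X ?A = (1 + fps_const fps_X * fps_X) * fps_dilate (fps_X ^ 2) ?A"
    using arg_cong[OF euler_series_dilate, of "fps_dilate fps_X"]
    by (simp add: fps_dilate_mult fps_dilate_one_plus_X fps_dilate_dilate power2_eq_square)
  then have A: "?A = (1 + fps_X) * ((1 + fps_const fps_X * fps_X) * fps_dilate (fps_X ^ 2) ?A)"
    using euler_series_dilate by metis
  have "(1 + fps_X) * ((1 - fps_X) * P) = ?A * ((1 - fps_X ^ 2) * ?B)"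
    by (simp add: P_def algebra_simps power2_eq_square)
  also have "\<dots> = ?A * fps_dilate (fps_X ^ 2) ?B"
    by (simp add: even_series_dilate)
  also have "\<dots> = (1 + fps_X) * ((1 + fps_const fps_X * fps_X) * fps_dilate (fps_X ^ 2) P)"
    by (subst A) (simp add: P_def fps_dilate_mult mult.assoc)
  finally have eq: "(1 + fps_X) * ((1 - fps_X) * P) =
    (1 + fps_X) * ((1 + fps_const fps_X * fps_X) * fps_dilate (fps_X ^ 2) P)" .
  have "(1 + fps_X :: 'a fps fps) $ 0 \<noteq> 0 $ 0"
    by simp
  then have "(1 + fps_X :: 'a fps fps) \<noteq> 0"
    by metis
  with eq show ?thesis
    by simp
qed

text \<open>Compare coefficients of z^(m+1) in \<open>product_series_dilate\<close>.\<close>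

lemma product_series_nth_Suc:
  defines "P \<equiv> euler_series * (even_series :: 'a::field fps fps)"
  shows "P $ Suc m * (1 - fps_X ^ (2 * m + 2)) = (1 + fps_X ^ (2 * m + 1)) * P $ m"
proof -
  have "P $ Suc m - P $ m =
      (fps_X ^ 2) ^ Suc m * P $ Suc m + fps_X * ((fps_X ^ 2) ^ m * P $ m)"
    using arg_cong[OF product_series_dilate, of "\<lambda>f :: 'a fps fps. f $ Suc m"]
    unfolding P_def[symmetric]
    by (simp add: left_diff_distrib distrib_right mult.assoc fps_dilate_nth)
  then show ?thesis
    unfolding power_mult[symmetric] by (simp add: algebra_simps)
qed

section \<open>Coefficients of the double sum\<close>

definition weight_pairs :: "nat \<Rightarrow> (nat \<times> nat) set" where
  "weight_pairs m = {(n1, n2). n1 + 2 * n2 = m}"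

lemma finite_weight_pairs: "finite (weight_pairs m)"
  by (rule finite_subset[of _ "{..m} \<times> {..m}"]) (auto simp: weight_pairs_def)

text \<open>A Cauchy product: \<open>n1 = i\<close> determines \<open>n2\<close>, and odd
  \<open>m - i\<close> contributes zero.\<close>

lemma sum_weight_pairs_eq_product_series_nth:
  "(\<Sum>(n1, n2)\<in>weight_pairs m. euler_coeff n1 * even_coeff n2) = (euler_series * even_series) $ m"
proof -
  have "(\<Sum>(n1, n2)\<in>weight_pairs m. euler_coeff n1 * even_coeff n2) =
    (\<Sum>i | i \<le> m \<and> even (m - i). euler_coeff i * even_coeff ((m - i) div 2))"
    by (rule sum.reindex_bij_witness[of _ "\<lambda>i. (i, (m - i) div 2)" fst])
       (auto simp: weight_pairs_def)
  also have "\<dots> = (\<Sum>i\<in>{0..m}. euler_series $ i * even_series $ (m - i))"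
    by (rule sum.mono_neutral_cong_left) (auto simp: euler_series_def even_series_def)
  finally show ?thesis
    by (simp add: fps_mult_nth)
qed

definition double_sum_coeff :: "nat \<Rightarrow> nat \<Rightarrow> 'a::field fps" where
  "double_sum_coeff n1 n2 =
     fps_X ^ (4 * n2\<^sup>2 + 4 * n2 + (3 * n1\<^sup>2 + 3 * n1) div 2 + 4 * n2 * n1) /
       (qpoch fps_X fps_X n1 * qpoch (fps_X ^ 4) (fps_X ^ 4) n2)"

text \<open>For m = n1 + 2 n2, the part 4 n2^2 + 4 n1 n2 + n1^2 + 4 n2 + 2 n1 of the exponent is m^2
  + 2m; the rest is \<open>n1 choose 2\<close>.\<close>

lemma double_sum_coeff_eq:
  assumes "(n1, n2) \<in> weight_pairs m"
  shows "double_sum_coeff n1 n2 = fps_X ^ (m\<^sup>2 + 2 * m) * (euler_coeff n1 * even_coeff n2)"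
proof -
  have "(3 * n1\<^sup>2 + 3 * n1) div 2 = n1\<^sup>2 + 2 * n1 + (n1 choose 2)"
  proof (induction n1)
    case (Suc n)
    have "3 * (Suc n)\<^sup>2 + 3 * Suc n = (3 * n\<^sup>2 + 3 * n) + (3 * n + 3) * 2"
      by (simp add: power2_eq_square)
    moreover have "Suc n choose 2 = n + (n choose 2)"
      by (simp add: numeral_2_eq_2)
    ultimately show ?case
      using Suc by (simp add: power2_eq_square)
  qed simp
  then have "4 * n2\<^sup>2 + 4 * n2 + (3 * n1\<^sup>2 + 3 * n1) div 2 + 4 * n2 * n1 =
      m\<^sup>2 + 2 * m + (n1 choose 2)"
    using assms by (auto simp: weight_pairs_def power2_eq_square algebra_simps)
  moreover have "(qpoch fps_X fps_X n1 * qpoch (fps_X ^ 4) (fps_X ^ 4) n2 :: 'a fps) $ 0 \<noteq> 0"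
    by (simp add: qpoch_nth_0)
  ultimately show ?thesis
    unfolding double_sum_coeff_def
    by (simp add: fps_divide_unit fps_inverse_mult euler_coeff_def even_coeff_def power_add mult_ac)
qed

text \<open>Both sides obey the same first-order recurrence in \<open>m\<close> and equal 1 at
  \<open>m = 0\<close>.\<close>

lemma sum_double_sum_coeff:
  "(\<Sum>(n1, n2)\<in>weight_pairs m. double_sum_coeff n1 n2) = (gap_gf 3 m :: 'a::field fps)"
proof -
  let ?P = "euler_series * even_series :: 'a fps fps"
  have "(\<Sum>(n1, n2)\<in>weight_pairs m. double_sum_coeff n1 n2) =
      (\<Sum>(n1, n2)\<in>weight_pairs m. fps_X ^ (m\<^sup>2 + 2 * m) * (euler_coeff n1 * even_coeff n2 :: 'a fps))"
    by (rule sum.cong) (auto simp: double_sum_coeff_eq)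
  also have "\<dots> = fps_X ^ (m\<^sup>2 + 2 * m) * ?P $ m"
    by (simp add: sum_distrib_left case_prod_unfold
        flip: sum_weight_pairs_eq_product_series_nth)
  also have "\<dots> = gap_gf 3 m"
  proof (induction m)
    case 0
    show ?case
      by (simp add: gap_gf_0 euler_series_def even_series_def euler_coeff_def even_coeff_def qpoch_def
          binomial_eq_0)
  next
    case (Suc m)
    have "(Suc m)\<^sup>2 + 2 * Suc m = (m\<^sup>2 + 2 * m) + (2 * m + 3)"
      by (simp add: power2_eq_square)
    then have "fps_X ^ ((Suc m)\<^sup>2 + 2 * Suc m) * ?P $ Suc m * (1 - fps_X ^ (2 * m + 2)) =
        fps_X ^ (2 * m + 3) * fps_X ^ (m\<^sup>2 + 2 * m) * (?P $ Suc m * (1 - fps_X ^ (2 * m + 2)))"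
      by (simp only: power_add mult_ac)
    also have "\<dots> = fps_X ^ (2 * m + 3) * (1 + fps_X ^ (2 * m + 1)) *
        (fps_X ^ (m\<^sup>2 + 2 * m) * ?P $ m)"
      unfolding product_series_nth_Suc by (simp only: mult_ac)
    also have "\<dots> = gap_gf 3 (Suc m) * (1 - fps_X ^ (2 * m + 2))"
      unfolding Suc.IH gap_gf_3_Suc ..
    finally have eq: "fps_X ^ ((Suc m)\<^sup>2 + 2 * Suc m) * ?P $ Suc m * (1 - fps_X ^ (2 * m + 2)) =
        gap_gf 3 (Suc m) * (1 - fps_X ^ (2 * m + 2))" .
    have "(1 - fps_X ^ (2 * m + 2) :: 'a fps) $ 0 \<noteq> 0 $ 0"
      by simp
    then have "(1 - fps_X ^ (2 * m + 2) :: 'a fps) \<noteq> 0"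
      by metis
    with eq show ?case
      by (metis mult_right_cancel)
  qed
  finally show ?thesis .
qed

section \<open>Coefficientwise convergence and the identity\<close>

lemma has_sum_fpsI:
  fixes f :: "'i \<Rightarrow> 'a::ab_group_add fps"
  assumes "\<And>m. finite (I m)" "\<And>m. I m \<subseteq> A"
    and "\<And>m i. i \<in> A - I m \<Longrightarrow> f i $ m = 0"
    and "\<And>m. (\<Sum>i\<in>I m. f i $ m) = F $ m"
  shows "(f has_sum F) A"
  unfolding has_sum_def
proof (rule tendsto_fpsI)
  fix m
  \<comment> \<open>Coefficient \<open>m\<close> is constant once \<open>J\<close> contains
    \<open>I m\<close>, which is what convergence of formal power series requires.\<close>
  have "sum f J $ m = F $ m" if "finite J" "I m \<subseteq> J" "J \<subseteq> A" for J
  proof -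
    have "sum f J $ m = (\<Sum>i\<in>J. f i $ m)"
      by (rule fps_sum_nth)
    also have "\<dots> = (\<Sum>i\<in>I m. f i $ m)"
      using that assms(3) by (intro sum.mono_neutral_right) auto
    finally show ?thesis
      using assms(4) by simp
  qed
  then show "\<forall>\<^sub>F J in finite_subsets_at_top A. sum f J $ m = F $ m"
    unfolding eventually_finite_subsets_at_top using assms(1,2) by (intro exI[of _ "I m"]) simp
qed

theorem theorem14:
  shows "let q = (fps_X :: rat fps); x = (fps_X :: rat fps fps) in
    ((\<lambda>(n1, n2).
        fps_const (q ^ (4 * n2\<^sup>2 + 4 * n2 + (3 * n1\<^sup>2 + 3 * n1) div 2 + 4 * n2 * n1)
                   / (qpoch q q n1 * qpoch (q ^ 4) (q ^ 4) n2))
        * (1 + x * fps_const (q ^ (4 * n2 + 2 * n1 + 2)))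
        * x ^ (2 * n2 + n1))
      has_sum bivariate_gf Do21) (UNIV :: (nat \<times> nat) set)"
proof -
  define f :: "nat \<times> nat \<Rightarrow> rat fps fps" where
    "f = (\<lambda>(n1, n2). fps_const (double_sum_coeff n1 n2)
        * (1 + fps_X * fps_const (fps_X ^ (4 * n2 + 2 * n1 + 2))) * fps_X ^ (2 * n2 + n1))"
  \<comment> \<open>The second term comes from the factor 1 + x q^(...): its exponent 4 n2 + 2 n1 +
    2 is \<open>2 * m\<close> when m = n1 + 2 n2 + 1.\<close>
  have f_nth: "f (n1, n2) $ m =
      (if n1 + 2 * n2 = m then double_sum_coeff n1 n2 else 0) +
      (if Suc (n1 + 2 * n2) = m then fps_X ^ (2 * m) * double_sum_coeff n1 n2 else 0)" for n1 n2 m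
  proof -
    have "f (n1, n2) = fps_const (double_sum_coeff n1 n2) * fps_X ^ (n1 + 2 * n2) +
        fps_const (fps_X ^ (2 * Suc (n1 + 2 * n2)) * double_sum_coeff n1 n2)
          * fps_X ^ Suc (n1 + 2 * n2)"
      unfolding f_def by (simp add: algebra_simps flip: fps_const_mult)
    then show ?thesis
      by (auto simp del: power_Suc simp: fps_X_power_nth)
  qed
  have "(f has_sum bivariate_gf Do21) UNIV"
  proof (rule has_sum_fpsI)
    fix m
    \<comment> \<open>A summand meets only the x-degrees n1 + 2 n2 and one more. The case split
      avoids counting degree 0 through the truncated \<open>m - 1\<close>.\<close>
    let ?I = "\<lambda>m. weight_pairs m \<union> (if m = 0 then {} else weight_pairs (m - 1))"
    show "finite (?I m)" "?I m \<subseteq> UNIV"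
      by (simp_all add: finite_weight_pairs)
    show "f i $ m = 0" if "i \<in> UNIV - ?I m" for i
      using that by (cases i) (auto simp: f_nth weight_pairs_def split: if_splits)
    have top: "(\<Sum>i\<in>weight_pairs m. f i $ m) = gap_gf 3 m"
      unfolding sum_double_sum_coeff[symmetric]
      by (rule sum.cong) (auto simp: f_nth weight_pairs_def)
    show "(\<Sum>i\<in>?I m. f i $ m) = bivariate_gf Do21 $ m"
    proof (cases m)
      case 0
      then show ?thesis
        using top by (simp add: bivariate_gf_Do21_nth gap_gf_0)
    next
      case (Suc k)
      have "(\<Sum>i\<in>weight_pairs k. f i $ m) =
          (\<Sum>(n1, n2)\<in>weight_pairs k. fps_X ^ (2 * k + 2) * double_sum_coeff n1 n2)"
        by (rule sum.cong) (auto simp: f_nth weight_pairs_def Suc)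
      also have "\<dots> = fps_X ^ (2 * k + 2) * gap_gf 3 k"
        by (simp add: sum_distrib_left case_prod_unfold flip: sum_double_sum_coeff)
      finally have shifted: "(\<Sum>i\<in>weight_pairs k. f i $ m) = fps_X ^ (2 * k + 2) * gap_gf 3 k" .
      have "weight_pairs m \<inter> weight_pairs k = {}"
        by (auto simp: weight_pairs_def Suc)
      then have "(\<Sum>i\<in>?I m. f i $ m) =
          (\<Sum>i\<in>weight_pairs m. f i $ m) + (\<Sum>i\<in>weight_pairs k. f i $ m)"
        by (simp add: Suc sum.union_disjoint finite_weight_pairs)
      also have "\<dots> = gap_gf 2 m"
        unfolding top shifted by (simp only: gap_gf_2_Suc Suc)
      finally show ?thesis
        by (simp only: bivariate_gf_Do21_nth)
    qed
  qed
  then show ?thesis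
    unfolding f_def double_sum_coeff_def Let_def .
qed

end
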